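(* There exists a constant $C>0$, depending only on $a_1,\dots,a_m$, $s_1,\dots,s_{m-1}$ and $N_1,\dots,N_{m-1}$, such that for every $f:B_1\to\mathbb{R}$ and every solution $u:\mathbb{R}^n\to\mathbb{R}$ of $Lu=f$ in $B_1$ one has $$\|\partial_{x_n}u\|_{L^\infty(B_{1/2})}\le C\,\big(\|f\|_{L^\infty(B_1)}+\|u\|_{L^\infty(\mathbb{R}^n)}\big).$$
   Context: Setting. $\{e_1,\dots,e_n\}$ is the Euclidean basis of $\mathbb{R}^n$ and $B_r$ is the open ball of $\mathbb{R}^n$ centered at the origin with radius $r$. Let $m\in\mathbb{N}$ and $N_1,\dots,N_{m-1}\in\mathbb{N}$ (positive integers) with $N_1+\dots+N_{m-1}=n-1$, and set $N_m:=1$. Put $N_i':=N_1+\dots+N_i$ and $N_0':=0$. The coordinates of $x=(x_1,\dots,x_n)\in\mathbb{R}^n$ are split into groups $X_i:=(x_{N_{i-1}'+1},\dots,x_{N_i'})\in\mathbb{R}^{N_i}$ for $i\in\{1,\dots,m-1\}$, and $X_m:=x_n$. For $y=(y_1,\dots,y_{N_i})\in\mathbb{R}^{N_i}$ let $y^{(i)}:=y_1e_{N_{i-1}'+1}+\dots+y_{N_i}e_{N_i'}\in\mathbb{R}^n$. For $s_i\in(0,1]$, define: if $s_i=1$, $(-\Delta_{X_i})^{s_i}u(x):=-\partial^2_{x_{N_{i-1}'+1}}u(x)-\dots-\partial^2_{x_{N_i'}}u(x)$; if $s_i\in(0,1)$, $$(-\Delta_{X_i})^{s_i}u(x):=c_{N_i,s_i}\int_{\mathbb{R}^{N_i}}\frac{2u(x)-u(x+y^{(i)})-u(x-y^{(i)})}{|y^{(i)}|^{N_i+2s_i}}\,dy,\qquad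 c_{N,s}:=\frac{2^{2s-1}\,\Gamma(s+\frac N2)}{\pi^{N/2}\,|\Gamma(-s)|}.$$ Given $a_1,\dots,a_{m-1}\ge0$, $a>0$ and $s_1,\dots,s_{m-1}\in(0,1]$, set $a_m:=a$, $s_m:=1$ and $$L:=\sum_{i=1}^{m-1}a_i(-\Delta_{X_i})^{s_i}-a\,\partial^2_{x_n}=\sum_{i=1}^m a_i(-\Delta_{X_i})^{s_i}.$$ Solutions are classical: "$u:\mathbb{R}^n\to\mathbb{R}$ is a solution of $Lu=f$ in $\Omega$" means that $u$ is continuous and smooth enough for $Lu(x)$ to be computed pointwise at every $x\in\Omega$, and $Lu(x)=f(x)$ there. The right-hand side of the estimate is understood in $[0,+\infty]$. *)

theory Defs
  imports "HOL-Analysis.Analysis"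
begin

text \<open>
  Points live in \<open>real ^ 'n\<close>, and the Euclidean basis $e_1,\dots,e_n$ is an enumeration
  \<open>e\<close> of \<open>Basis\<close> by \<open>{1..CARD('n)}\<close>. A point of $R^{N_i}$ is a function on the index
  set \<open>{1..N i}\<close>, with Lebesgue measure \<open>\<Pi>\<^sub>M k\<in>{1..N i}. lborel\<close>, so that groups of
  different sizes can occur in one formula.
\<close>

definition offset :: "(nat \<Rightarrow> nat) \<Rightarrow> nat \<Rightarrow> nat" where
  "offset N i = (\<Sum>k=1..i. N k)"

text \<open>The basis vector $e_{N'_{i-1}+k}$ and the embedding $y \mapsto y^{(i)}$.\<close>

definition group_vec :: "(nat \<Rightarrow> real ^ 'n) \<Rightarrow> (nat \<Rightarrow> nat) \<Rightarrow> nat \<Rightarrow> nat \<Rightarrow> real ^ 'n" where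
  "group_vec e N i k = e (offset N (i - 1) + k)"

definition embed :: "(nat \<Rightarrow> real ^ 'n) \<Rightarrow> (nat \<Rightarrow> nat) \<Rightarrow> nat \<Rightarrow> (nat \<Rightarrow> real) \<Rightarrow> real ^ 'n" where
  "embed e N i y = (\<Sum>k=1..N i. y k *\<^sub>R group_vec e N i k)"

definition partial_deriv :: "real ^ 'n \<Rightarrow> (real ^ 'n \<Rightarrow> real) \<Rightarrow> real ^ 'n \<Rightarrow> real" where
  "partial_deriv v u x = deriv (\<lambda>t. u (x + t *\<^sub>R v)) 0"

definition has_second_partial :: "real ^ 'n \<Rightarrow> (real ^ 'n \<Rightarrow> real) \<Rightarrow> real ^ 'n \<Rightarrow> bool" where
  "has_second_partial v u x \<longleftrightarrow>
     (\<forall>\<^sub>F t in nhds 0. (\<lambda>r. u (x + r *\<^sub>R v)) differentiable (at t)) \<and>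
     (\<lambda>t. partial_deriv v u (x + t *\<^sub>R v)) differentiable (at 0)"

definition frac_const :: "nat \<Rightarrow> real \<Rightarrow> real" where
  "frac_const d \<sigma> = 2 powr (2 * \<sigma> - 1) * Gamma (\<sigma> + real d / 2)
                     / (pi powr (real d / 2) * \<bar>Gamma (- \<sigma>)\<bar>)"

definition frac_integrand ::
  "(nat \<Rightarrow> real ^ 'n) \<Rightarrow> (nat \<Rightarrow> nat) \<Rightarrow> nat \<Rightarrow> real \<Rightarrow> (real ^ 'n \<Rightarrow> real) \<Rightarrow> real ^ 'n \<Rightarrow> (nat \<Rightarrow> real) \<Rightarrow> real"
  where
  "frac_integrand e N i \<sigma> u x y =
     (2 * u x - u (x + embed e N i y) - u (x - embed e N i y))
       / norm (embed e N i y) powr (real (N i) + 2 * \<sigma>)"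

definition frac_lap ::
  "(nat \<Rightarrow> real ^ 'n) \<Rightarrow> (nat \<Rightarrow> nat) \<Rightarrow> nat \<Rightarrow> real \<Rightarrow> (real ^ 'n \<Rightarrow> real) \<Rightarrow> real ^ 'n \<Rightarrow> real" where
  "frac_lap e N i \<sigma> u x =
     (if \<sigma> = 1
      then - (\<Sum>k=1..N i. partial_deriv (group_vec e N i k) (partial_deriv (group_vec e N i k) u) x)
      else frac_const (N i) \<sigma> *
           (\<integral>y. frac_integrand e N i \<sigma> u x y \<partial>(\<Pi>\<^sub>M k\<in>{1..N i}. lborel)))"

text \<open>
  \<open>deriv\<close> and the Bochner integral are total functions, so the fact that the expression above
  makes sense at \<open>x\<close> has to be recorded separately.
\<close>

definition frac_lap_computable ::
  "(nat \<Rightarrow> real ^ 'n) \<Rightarrow> (nat \<Rightarrow> nat) \<Rightarrow> nat \<Rightarrow> real \<Rightarrow> (real ^ 'n \<Rightarrow> real) \<Rightarrow> real ^ 'n \<Rightarrow> bool" where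
  "frac_lap_computable e N i \<sigma> u x \<longleftrightarrow>
     (if \<sigma> = 1
      then \<forall>k\<in>{1..N i}. has_second_partial (group_vec e N i k) u x
      else integrable (\<Pi>\<^sub>M k\<in>{1..N i}. lborel) (frac_integrand e N i \<sigma> u x))"

definition L_op ::
  "(nat \<Rightarrow> real ^ 'n) \<Rightarrow> nat \<Rightarrow> (nat \<Rightarrow> nat) \<Rightarrow> (nat \<Rightarrow> real) \<Rightarrow> (nat \<Rightarrow> real)
     \<Rightarrow> (real ^ 'n \<Rightarrow> real) \<Rightarrow> real ^ 'n \<Rightarrow> real" where
  "L_op e m N a s u x = (\<Sum>i=1..m. a i * frac_lap e N i (s i) u x)"

text \<open>
  Classical solutions. No regularity in the group $X_i$ beyond continuity is asked for when
  $a_i = 0$, since that group does not enter $L$.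
\<close>

definition classical_solution ::
  "(nat \<Rightarrow> real ^ 'n) \<Rightarrow> nat \<Rightarrow> (nat \<Rightarrow> nat) \<Rightarrow> (nat \<Rightarrow> real) \<Rightarrow> (nat \<Rightarrow> real)
     \<Rightarrow> (real ^ 'n) set \<Rightarrow> (real ^ 'n \<Rightarrow> real) \<Rightarrow> (real ^ 'n \<Rightarrow> real) \<Rightarrow> bool" where
  "classical_solution e m N a s \<Omega> f u \<longleftrightarrow>
     continuous_on UNIV u \<and>
     (\<forall>x\<in>\<Omega>. (\<forall>i\<in>{1..m}. a i \<noteq> 0 \<longrightarrow> frac_lap_computable e N i (s i) u x) \<and>
             L_op e m N a s u x = f x)"

text \<open>
  The norm of $L^\infty(S)$ for a function given pointwise, with values in $[0,\infty]$: the
  supremum of \<open>\<bar>g\<bar>\<close> over all points of \<open>S\<close>. The equation holds at every point and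
  its right-hand side is an arbitrary function (not an almost-everywhere class, and not assumed
  measurable), so no null sets are discarded. On an open set this is the essential supremum as
  soon as \<open>g\<close> is continuous.
\<close>

definition Linf_norm :: "(real ^ 'n) set \<Rightarrow> (real ^ 'n \<Rightarrow> real) \<Rightarrow> ennreal" where
  "Linf_norm S g = (SUP x\<in>S. ennreal \<bar>g x\<bar>)"

end

theory Submission
  imports Defs
begin

text \<open>
  The idea is to compare \<open>u\<close> with its reflection in a hyperplane orthogonal to $w = \pm e_n$.
  Fix \<open>x0\<close> in the half ball and put $\varphi(z,t) = u(x_0 + z + t w) - u(x_0 + z - t w)$ for
  \<open>z\<close> orthogonal to \<open>w\<close> and $0 \le t \le 1/4$. All groups but the last act on
  \<open>z\<close> alone, and the last one is the local operator $-a\,\partial_n^2$, which on $\varphi$ is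
  $-a\,\partial_t^2$. So $\varphi$ solves an equation in the variables \<open>(z, t)\<close> with
  right-hand side at most $2\|f\|$, it vanishes for $t = 0$, and it is at most $2\|u\|$ everywhere.

  For $W > \|f\| + \|u\|$ the function $W (\eta(z) + (8 + B/4) t - B t^2)$ with
  $\eta(z) = \min(32 |z|^2, 2)$ is a barrier. It is at least $2W$ both for $t = 1/4$ and for
  $|z| \ge 1/4$, so if $\varphi$ exceeds it somewhere, the excess attains its maximum over
  the strip $0 \le t \le 1/4$ at a point with $0 < t < 1/4$ (\<open>touching_points\<close>). There the
  increments of $\varphi$ are at most those of the barrier. In the \<open>z\<close> directions this costs at most a
  constant multiple of \<open>W\<close>; in the direction \<open>t\<close> it gains $2aBW$. For \<open>B\<close> large
  this contradicts the equation (\<open>solution_symmetric_difference_le\<close>). Hence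
  $\varphi(0,t) \le (8 + B/4) W t$, and dividing by $2t$ bounds the derivative.

  The maximum gives inequalities between second differences of \<open>u\<close> at two points, so the
  barrier needs no derivatives and no fractional Laplacian of its own. It is enough that $\eta$
  is bounded and semiconcave: its second differences are bounded on one side by a multiple of
  $\min(|y|^2, 1)$, which is integrable against $|y|^{-d-2\sigma}$
  (\<open>integrable_levy_kernel\<close>). The lemma \<open>frac_lap_diff_ge\<close> turns such a bound
  into one for the local and for the nonlocal operators alike.
\<close>

section \<open>Second differences and second derivatives\<close>

text \<open>The sign is that of the numerator of the fractional Laplacian.\<close>

definition second_diff :: "('a::real_vector \<Rightarrow> real) \<Rightarrow> 'a \<Rightarrow> 'a \<Rightarrow> real" where
  "second_diff u x y = 2 * u x - u (x + y) - u (x - y)"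

text \<open>
  With $g = g_1 - g_2$, the second difference at \<open>0\<close> has derivative $g'(-h) - g'(h)$ in
  \<open>h\<close>, and the slope of that at $h = 0$ is $-2 g''(0)$. If this were less than $2c$, the second
  difference would be less than $c h^2$ for small $h > 0$. This route
  asks for differentiability of $g'$ at the single point \<open>0\<close> only.
\<close>

lemma second_deriv_le_of_second_diff:
  fixes g1 g2 :: "real \<Rightarrow> real"
  assumes "\<forall>\<^sub>F t in nhds 0. g1 differentiable (at t)" "deriv g1 differentiable (at 0)"
    and "\<forall>\<^sub>F t in nhds 0. g2 differentiable (at t)" "deriv g2 differentiable (at 0)"
    and le: "\<forall>\<^sub>F h in at_right 0. c * h\<^sup>2 \<le> second_diff g1 0 h - second_diff g2 0 h"
  shows "deriv (deriv g1) 0 - deriv (deriv g2) 0 \<le> - c"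
proof (rule ccontr)
  assume contra: "\<not> ?thesis"
  obtain d1 where d1: "d1 > 0" "\<And>t. \<bar>t\<bar> < d1 \<Longrightarrow> g1 differentiable (at t)"
    using assms(1) by (auto simp: eventually_nhds_metric)
  obtain d2 where d2: "d2 > 0" "\<And>t. \<bar>t\<bar> < d2 \<Longrightarrow> g2 differentiable (at t)"
    using assms(3) by (auto simp: eventually_nhds_metric)
  have D1: "(g1 has_real_derivative deriv g1 t) (at t)" if "\<bar>t\<bar> < d1" for t
    using d1(2)[OF that] by (simp add: DERIV_deriv_iff_real_differentiable)
  have D2: "(g2 has_real_derivative deriv g2 t) (at t)" if "\<bar>t\<bar> < d2" for t
    using d2(2)[OF that] by (simp add: DERIV_deriv_iff_real_differentiable)
  define E where "E h = second_diff g1 0 h - second_diff g2 0 h - c * h\<^sup>2" for h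
  define E' where "E' h = - deriv g1 h + deriv g1 (- h) + deriv g2 h - deriv g2 (- h) - 2 * c * h" for h
  have DE: "(E has_real_derivative E' h) (at h)" if "\<bar>h\<bar> < min d1 d2" for h
  proof -
    have m1: "((\<lambda>h. g1 (- h)) has_real_derivative - deriv g1 (- h)) (at h)"
      using D1[of "- h"] that by (simp add: DERIV_mirror)
    have m2: "((\<lambda>h. g2 (- h)) has_real_derivative - deriv g2 (- h)) (at h)"
      using D2[of "- h"] that by (simp add: DERIV_mirror)
    show ?thesis
      unfolding E_def E'_def second_diff_def
      using that by (auto intro!: derivative_eq_intros D1 D2 m1 m2)
  qed
  have dd1: "(deriv g1 has_real_derivative deriv (deriv g1) 0) (at 0)"
    and dd2: "(deriv g2 has_real_derivative deriv (deriv g2) 0) (at 0)"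
    using assms(2,4) by (simp_all add: DERIV_deriv_iff_real_differentiable)
  have m1: "((\<lambda>h. deriv g1 (- h)) has_real_derivative - deriv (deriv g1) 0) (at 0)"
    using dd1 by (simp flip: DERIV_mirror)
  have m2: "((\<lambda>h. deriv g2 (- h)) has_real_derivative - deriv (deriv g2) 0) (at 0)"
    using dd2 by (simp flip: DERIV_mirror)
  have "(E' has_real_derivative (- 2 * (deriv (deriv g1) 0 - deriv (deriv g2) 0 + c))) (at 0)"
    unfolding E'_def by (auto intro!: derivative_eq_intros dd1 dd2 m1 m2)
  moreover have "- 2 * (deriv (deriv g1) 0 - deriv (deriv g2) 0 + c) < 0"
    using contra by simp
  ultimately obtain d3 where d3: "d3 > 0" "\<And>h. 0 < h \<Longrightarrow> h < d3 \<Longrightarrow> E' h < E' 0"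
    using DERIV_neg_dec_right[of E' _ 0] by (metis add_0)
  obtain d4 where d4: "d4 > 0" "\<And>h. 0 < h \<Longrightarrow> h < d4 \<Longrightarrow> 0 \<le> E h"
    using le unfolding eventually_at_right_field E_def by (auto simp: algebra_simps)
  define h where "h = min (min d1 d2) (min d3 d4) / 2"
  have h: "0 < h" "h < min d1 d2" "h < d3" "h < d4"
    using d1 d2 d3 d4 by (auto simp: h_def)
  have "E h < E 0"
  proof (rule DERIV_neg_imp_decreasing_open[OF \<open>0 < h\<close>])
    show "\<exists>y. (E has_real_derivative y) (at t) \<and> y < 0" if "0 < t" "t < h" for t
      using DE[of t] d3(2)[of t] that h by (auto simp: E'_def)
    show "continuous_on {0..h} E"
      by (rule DERIV_continuous_on, rule DERIV_subset, rule DE) (use h in auto)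
  qed
  moreover have "E 0 = 0" by (simp add: E_def second_diff_def)
  ultimately show False using d4(2)[of h] h by simp
qed

lemma second_partial_le_of_second_diff:
  fixes u :: "real ^ 'n \<Rightarrow> real"
  assumes "has_second_partial v u p" "has_second_partial v u q"
    and le: "\<forall>\<^sub>F h in at_right 0.
      c * h\<^sup>2 \<le> second_diff u p (h *\<^sub>R v) - second_diff u q (h *\<^sub>R v)"
  shows "partial_deriv v (partial_deriv v u) p - partial_deriv v (partial_deriv v u) q \<le> - c"
proof -
  have shift: "partial_deriv v u (x + t *\<^sub>R v) = deriv (\<lambda>r. u (x + r *\<^sub>R v)) t" for x t
  proof -
    have "((\<lambda>s. u (x + t *\<^sub>R v + s *\<^sub>R v)) has_real_derivative D) (at 0) \<longleftrightarrow>
          ((\<lambda>r. u (x + r *\<^sub>R v)) has_real_derivative D) (at t)" for D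
      using DERIV_shift[of "\<lambda>r. u (x + r *\<^sub>R v)" D 0 t] by (simp add: algebra_simps)
    then show ?thesis by (simp add: partial_deriv_def deriv_def)
  qed
  have twice: "partial_deriv v (partial_deriv v u) x = deriv (deriv (\<lambda>r. u (x + r *\<^sub>R v))) 0" for x
    by (subst (1) partial_deriv_def) (simp only: shift eta_contract_eq)
  have "deriv (deriv (\<lambda>r. u (p + r *\<^sub>R v))) 0 - deriv (deriv (\<lambda>r. u (q + r *\<^sub>R v))) 0 \<le> - c"
    using assms(1,2) le
    by (intro second_deriv_le_of_second_diff) (simp_all add: has_second_partial_def shift second_diff_def)
  then show ?thesis by (simp only: twice)
qed

section \<open>Integrability of the truncated kernel\<close>

text \<open>
  The sum of the functions that are constantly \<open>b k\<close> on \<open>A k\<close> dominates \<open>K\<close>.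
\<close>

lemma integrable_of_countable_cover:
  fixes K :: "'a \<Rightarrow> real" and b \<mu> :: "nat \<Rightarrow> real"
  assumes "K \<in> borel_measurable M" "\<And>y. y \<in> space M \<Longrightarrow> 0 \<le> K y"
    and A: "\<And>k. A k \<in> sets M" "\<And>k. emeasure M (A k) = ennreal (\<mu> k)"
    and nonneg: "\<And>k. 0 \<le> b k" "\<And>k. 0 \<le> \<mu> k"
    and "summable (\<lambda>k. b k * \<mu> k)"
    and cover: "\<And>y. y \<in> space M \<Longrightarrow> K y > 0 \<Longrightarrow> \<exists>k. y \<in> A k \<and> K y \<le> b k"
  shows "integrable M K"
proof (rule integrableI_nonneg)
  have "(\<integral>\<^sup>+ y. ennreal (K y) \<partial>M) \<le> (\<integral>\<^sup>+ y. (\<Sum>k. ennreal (b k) * indicator (A k) y) \<partial>M)"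
  proof (rule nn_integral_mono)
    fix y assume y: "y \<in> space M"
    show "ennreal (K y) \<le> (\<Sum>k. ennreal (b k) * indicator (A k) y)"
    proof (cases "K y > 0")
      case True
      then obtain k where k: "y \<in> A k" "K y \<le> b k" using cover y by blast
      then have "ennreal (K y) \<le> (\<Sum>j\<in>{k}. ennreal (b j) * indicator (A j) y)"
        by (simp add: ennreal_leI)
      also have "\<dots> \<le> (\<Sum>j. ennreal (b j) * indicator (A j) y)"
        by (rule sum_le_suminf) auto
      finally show ?thesis .
    qed (simp add: ennreal_neg)
  qed
  also have "\<dots> = (\<Sum>k. ennreal (b k * \<mu> k))"
    using A nonneg by (subst nn_integral_suminf) (auto simp: nn_integral_cmult_indicator ennreal_mult)
  also have "\<dots> < \<infinity>"
    using assms(7) nonneg by (subst suminf_ennreal2) auto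
  finally show "(\<integral>\<^sup>+ y. ennreal (K y) \<partial>M) < \<infinity>" .
qed (use assms in auto)

lemma dyadic_interval:
  fixes r :: real
  assumes "1 \<le> r"
  obtains k :: nat where "2 ^ k \<le> r" "r < 2 * 2 ^ k"
proof -
  obtain n where "r < 2 ^ n" using real_arch_pow[of 2 r] by auto
  with assms obtain k where "\<forall>i\<le>k. \<not> r < 2 ^ i" "r < 2 ^ Suc k"
    using ex_least_nat_less[of "\<lambda>n. r < 2 ^ n" n] by auto
  then show ?thesis using that[of k] by auto
qed

lemma emeasure_PiM_cube:
  fixes R :: real
  assumes "0 \<le> R" "finite I"
  shows "emeasure (\<Pi>\<^sub>M k\<in>I. lborel) (\<Pi>\<^sub>E k\<in>I. {-R..R}) = ennreal ((2 * R) ^ card I)"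
proof -
  interpret product_sigma_finite "\<lambda>_. lborel :: real measure" by standard
  show ?thesis
    using assms by (subst emeasure_PiM) (auto simp: prod_ennreal ennreal_power)
qed

text \<open>
  $\min(|y|^2,1) / |y|^{d+2\sigma}$ on $R^d$, with points represented as functions on \<open>{1..d}\<close>.
\<close>

definition levy_kernel :: "nat \<Rightarrow> real \<Rightarrow> (nat \<Rightarrow> real) \<Rightarrow> real" where
  "levy_kernel d \<sigma> y =
     min ((L2_set y {1..d})\<^sup>2) 1 / L2_set y {1..d} powr (real d + 2 * \<sigma>)"

text \<open>
  On the dyadic shell $2^k \le |y| < 2^{k+1}$, contained in a cube of volume comparable to
  $2^{kd}$, the kernel is at most a constant times $2^{-k(d+2\sigma)}$ for $k \ge 0$ and
  $2^{k(2-d-2\sigma)}$ for $k < 0$. The shells outside and inside the unit ball thus contribute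
  geometric series of ratios $2^{-2\sigma}$ and $2^{2\sigma-2}$.
\<close>

lemma integrable_levy_kernel:
  assumes "0 < \<sigma>" "\<sigma> < 1"
  shows "integrable (\<Pi>\<^sub>M k\<in>{1..d}. lborel) (levy_kernel d \<sigma>)"
proof -
  let ?M = "\<Pi>\<^sub>M k\<in>{1..d}. (lborel :: real measure)"
  let ?r = "\<lambda>y. L2_set y {1..d}"
  let ?Q = "\<lambda>R::real. \<Pi>\<^sub>E k\<in>{1..d}. {-R..R}"
  define \<alpha> where "\<alpha> = real d + 2 * \<sigma>"
  have [measurable]: "?r \<in> borel_measurable ?M" unfolding L2_set_def by measurable
  have cube: "y \<in> ?Q R" if "y \<in> space ?M" "?r y \<le> R" for y R
  proof -
    have "\<bar>y k\<bar> \<le> R" if "k \<in> {1..d}" for k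
      using member_le_L2_set[of "{1..d}" k "\<lambda>k. \<bar>y k\<bar>"] that \<open>?r y \<le> R\<close>
      by (auto simp: L2_set_def)
    then show ?thesis using that(1) by (force simp: space_PiM PiE_iff abs_le_iff)
  qed
  have sets: "?Q R \<in> sets ?M" for R by (rule sets_PiM_I_finite) auto
  have outer: "integrable ?M (\<lambda>y. if 1 \<le> ?r y then ?r y powr (- \<alpha>) else 0)"
  proof (rule integrable_of_countable_cover[where A = "\<lambda>k. ?Q (2 * 2 ^ k)"
        and b = "\<lambda>k. (2 ^ k) powr (- \<alpha>)" and \<mu> = "\<lambda>k. (2 * (2 * 2 ^ k)) ^ d"])
    show "emeasure ?M (?Q (2 * 2 ^ k)) = ennreal ((2 * (2 * 2 ^ k)) ^ d)" for k
      by (subst emeasure_PiM_cube) auto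
    have eq: "(2 ^ k) powr (- \<alpha>) * (2 * (2 * 2 ^ k)) ^ d = 4 ^ d * (2 powr (- 2 * \<sigma>)) ^ k" for k :: nat
    proof -
      have "(2 ^ k) powr (- \<alpha>) * ((2::real) ^ k) ^ d = (2 ^ k) powr (- \<alpha>) * (2 ^ k) powr (real d)"
        by (simp add: powr_realpow)
      also have "\<dots> = (2 ^ k) powr (- 2 * \<sigma>)"
        by (simp add: \<alpha>_def flip: powr_add)
      also have "\<dots> = (2 powr (- 2 * \<sigma>)) ^ k"
        by (simp add: powr_powr mult.commute flip: powr_realpow)
      finally show ?thesis by (simp add: power_mult_distrib algebra_simps flip: power_mult_distrib[of 2 2 d])
    qed
    have "2 powr (- 2 * \<sigma>) < 2 powr 0" using assms by (intro powr_less_mono) auto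
    then show "summable (\<lambda>k. (2 ^ k) powr (- \<alpha>) * (2 * (2 * 2 ^ k)) ^ d)"
      unfolding eq by (intro summable_mult summable_geometric) auto
    fix y assume y: "y \<in> space ?M" and "0 < (if 1 \<le> ?r y then ?r y powr (- \<alpha>) else 0)"
    then have r: "1 \<le> ?r y" by (auto split: if_splits)
    obtain k where k: "2 ^ k \<le> ?r y" "?r y < 2 * 2 ^ k" using dyadic_interval[OF r] .
    have "?r y powr (- \<alpha>) \<le> (2 ^ k) powr (- \<alpha>)"
      using k assms by (intro powr_mono2') (auto simp: \<alpha>_def)
    then show "\<exists>k. y \<in> ?Q (2 * 2 ^ k) \<and> (if 1 \<le> ?r y then ?r y powr (- \<alpha>) else 0) \<le> (2 ^ k) powr (- \<alpha>)"
      using r k cube[OF y, of "2 * 2 ^ k"] by auto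
  qed (use sets in \<open>auto simp del: One_nat_def\<close>)
  have inner: "integrable ?M (\<lambda>y. if ?r y < 1 then (?r y)\<^sup>2 * ?r y powr (- \<alpha>) else 0)"
  proof (rule integrable_of_countable_cover[where A = "\<lambda>k. ?Q (1 / 2 ^ k)"
        and b = "\<lambda>k. (1 / 2 ^ k)\<^sup>2 * (1 / (2 * 2 ^ k)) powr (- \<alpha>)" and \<mu> = "\<lambda>k. (2 * (1 / 2 ^ k)) ^ d"])
    show "emeasure ?M (?Q (1 / 2 ^ k)) = ennreal ((2 * (1 / 2 ^ k)) ^ d)" for k
      by (subst emeasure_PiM_cube) auto
    have eq: "(1 / 2 ^ k)\<^sup>2 * (1 / (2 * 2 ^ k)) powr (- \<alpha>) * (2 * (1 / 2 ^ k)) ^ d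
        = 2 powr \<alpha> * 2 ^ d * (2 powr (2 * \<sigma> - 2)) ^ k" for k :: nat
    proof -
      define x :: real where "x = 2 ^ k"
      have x: "x > 0" by (simp add: x_def)
      have "(1 / x)\<^sup>2 * (1 / (2 * x)) powr (- \<alpha>) * (2 * (1 / x)) ^ d
          = 2 powr \<alpha> * 2 ^ d * (x powr (- 2) * x powr \<alpha> * x powr (- real d))"
        using x by (simp add: powr_minus powr_divide powr_mult powr_realpow power_divide field_simps)
      also have "x powr (- 2) * x powr \<alpha> * x powr (- real d) = x powr (2 * \<sigma> - 2)"
        by (simp add: \<alpha>_def flip: powr_add)
      also have "\<dots> = (2 powr (2 * \<sigma> - 2)) ^ k"
        by (simp add: x_def powr_powr mult.commute flip: powr_realpow)
      finally show ?thesis by (simp add: x_def)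
    qed
    have "2 powr (2 * \<sigma> - 2) < 2 powr 0" using assms by (intro powr_less_mono) auto
    then show "summable (\<lambda>k. (1 / 2 ^ k)\<^sup>2 * (1 / (2 * 2 ^ k)) powr (- \<alpha>) * (2 * (1 / 2 ^ k)) ^ d)"
      unfolding eq by (intro summable_mult summable_geometric) auto
    fix y assume y: "y \<in> space ?M"
      and pos: "0 < (if ?r y < 1 then (?r y)\<^sup>2 * ?r y powr (- \<alpha>) else 0)"
    then have r: "0 < ?r y" "?r y < 1"
      by (auto split: if_splits simp: less_le L2_set_nonneg)
    obtain k where k: "2 ^ k \<le> 1 / ?r y" "1 / ?r y < 2 * 2 ^ k"
      using dyadic_interval[of "1 / ?r y"] r by auto
    then have k': "?r y \<le> 1 / 2 ^ k" "1 / (2 * 2 ^ k) \<le> ?r y"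
      using r by (auto simp: field_simps)
    have "(?r y)\<^sup>2 * ?r y powr (- \<alpha>) \<le> (1 / 2 ^ k)\<^sup>2 * (1 / (2 * 2 ^ k)) powr (- \<alpha>)"
      using k' r assms by (intro mult_mono power_mono powr_mono2') (auto simp: \<alpha>_def)
    then show "\<exists>k. y \<in> ?Q (1 / 2 ^ k) \<and> (if ?r y < 1 then (?r y)\<^sup>2 * ?r y powr (- \<alpha>) else 0)
        \<le> (1 / 2 ^ k)\<^sup>2 * (1 / (2 * 2 ^ k)) powr (- \<alpha>)"
      using r k' cube[OF y, of "1 / 2 ^ k"] by auto
  qed (use sets in \<open>auto simp del: One_nat_def\<close>)
  have "levy_kernel d \<sigma> y = (if 1 \<le> ?r y then ?r y powr (- \<alpha>) else 0)
      + (if ?r y < 1 then (?r y)\<^sup>2 * ?r y powr (- \<alpha>) else 0)" for y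
    unfolding levy_kernel_def \<alpha>_def[symmetric]
    by (auto simp: powr_minus divide_inverse min_def power_le_one_iff L2_set_nonneg)
  then have "levy_kernel d \<sigma> = (\<lambda>y. (if 1 \<le> ?r y then ?r y powr (- \<alpha>) else 0)
      + (if ?r y < 1 then (?r y)\<^sup>2 * ?r y powr (- \<alpha>) else 0))" by blast
  then show ?thesis using Bochner_Integration.integrable_add[OF outer inner] by (simp only:)
qed

section \<open>Comparing the operator at two points\<close>

text \<open>
  How large the operator of one group can be, in absolute value, on a function whose second
  differences are between $- \min(|y|^2,1)$ and $\min(|y|^2,1)$: a second derivative in each of
  the \<open>d\<close> directions is then at most \<open>1\<close>.
\<close>

definition lap_bound :: "nat \<Rightarrow> real \<Rightarrow> real" where
  "lap_bound d \<sigma> = (if \<sigma> = 1 then real d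
     else frac_const d \<sigma> * (\<integral>y. levy_kernel d \<sigma> y \<partial>(\<Pi>\<^sub>M k\<in>{1..d}. lborel)))"

lemma frac_const_nonneg: "0 < \<sigma> \<Longrightarrow> 0 \<le> frac_const d \<sigma>"
  unfolding frac_const_def by (intro divide_nonneg_nonneg mult_nonneg_nonneg less_imp_le[OF Gamma_real_pos]) auto

lemma lap_bound_nonneg: "0 < \<sigma> \<Longrightarrow> 0 \<le> lap_bound d \<sigma>"
  by (auto simp: lap_bound_def levy_kernel_def frac_const_nonneg intro!: mult_nonneg_nonneg integral_nonneg)

lemma norm_embed:
  assumes "\<And>j k. j \<in> {1..N i} \<Longrightarrow> k \<in> {1..N i} \<Longrightarrow>
      group_vec e N i j \<bullet> group_vec e N i k = (if j = k then 1 else 0)"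
  shows "norm (embed e N i y) = L2_set y {1..N i}"
proof -
  have "(norm (embed e N i y))\<^sup>2 = (\<Sum>k=1..N i. (norm (y k *\<^sub>R group_vec e N i k))\<^sup>2)"
    unfolding embed_def
    by (rule norm_sum_Pythagorean) (auto simp: pairwise_def orthogonal_def assms)
  also have "\<dots> = (\<Sum>k=1..N i. (y k)\<^sup>2)"
    by (rule sum.cong) (auto simp: power_mult_distrib power2_norm_eq_inner assms)
  finally show ?thesis
    by (metis L2_set_def norm_ge_zero real_sqrt_unique)
qed

text \<open>
  For $\sigma < 1$ the hypothesis is integrated against the kernel. For $\sigma = 1$ it is used
  along each basis vector of the group, where it bounds a second derivative.
\<close>

lemma frac_lap_diff_ge:
  fixes u :: "real ^ 'n \<Rightarrow> real"
  assumes orth: "\<And>j k. j \<in> {1..N i} \<Longrightarrow> k \<in> {1..N i} \<Longrightarrow>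
      group_vec e N i j \<bullet> group_vec e N i k = (if j = k then 1 else 0)"
    and \<sigma>: "0 < \<sigma>" "\<sigma> \<le> 1"
    and comp: "frac_lap_computable e N i \<sigma> u p" "frac_lap_computable e N i \<sigma> u q"
    and "0 \<le> c"
    and ge: "\<And>z. - c * min ((norm (embed e N i z))\<^sup>2) 1
        \<le> second_diff u p (embed e N i z) - second_diff u q (embed e N i z)"
  shows "- c * lap_bound (N i) \<sigma> \<le> frac_lap e N i \<sigma> u p - frac_lap e N i \<sigma> u q"
proof (cases "\<sigma> = 1")
  case True
  have "partial_deriv (group_vec e N i k) (partial_deriv (group_vec e N i k) u) p
      - partial_deriv (group_vec e N i k) (partial_deriv (group_vec e N i k) u) q \<le> c"
    if k: "k \<in> {1..N i}" for k
  proof -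
    let ?v = "group_vec e N i k"
    have axis: "embed e N i (\<lambda>j. if j = k then h else 0) = h *\<^sub>R ?v" for h
    proof -
      have "embed e N i (\<lambda>j. if j = k then h else 0) = (\<Sum>j=1..N i. if j = k then h *\<^sub>R ?v else 0)"
        unfolding embed_def by (rule sum.cong) auto
      then show ?thesis using k by (simp add: sum.delta)
    qed
    have "- c * h\<^sup>2 \<le> second_diff u p (h *\<^sub>R ?v) - second_diff u q (h *\<^sub>R ?v)" for h
    proof -
      have "c * min (h\<^sup>2 * (norm ?v)\<^sup>2) 1 \<le> c * h\<^sup>2"
        using \<open>0 \<le> c\<close> orth[OF k k] by (intro mult_left_mono) (auto simp: power2_norm_eq_inner)
      then show ?thesis
        using ge[of "\<lambda>j. if j = k then h else 0"] unfolding axis by (simp add: power_mult_distrib)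
    qed
    then show ?thesis
      using second_partial_le_of_second_diff[of ?v u p q "- c"] comp k True
      by (simp add: frac_lap_computable_def)
  qed
  then have "(\<Sum>k=1..N i. partial_deriv (group_vec e N i k) (partial_deriv (group_vec e N i k) u) p
      - partial_deriv (group_vec e N i k) (partial_deriv (group_vec e N i k) u) q) \<le> (\<Sum>k=1..N i. c)"
    by (rule sum_mono)
  then show ?thesis
    using True by (simp add: frac_lap_def lap_bound_def sum_subtractf algebra_simps)
next
  case False
  let ?M = "\<Pi>\<^sub>M k\<in>{1..N i}. (lborel :: real measure)"
  have int: "integrable ?M (frac_integrand e N i \<sigma> u p)" "integrable ?M (frac_integrand e N i \<sigma> u q)"
    using comp False by (auto simp: frac_lap_computable_def)
  have "- c * integral\<^sup>L ?M (levy_kernel (N i) \<sigma>)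
      = (\<integral>y. - c * levy_kernel (N i) \<sigma> y \<partial>?M)" by simp
  also have "\<dots> \<le> (\<integral>y. frac_integrand e N i \<sigma> u p y - frac_integrand e N i \<sigma> u q y \<partial>?M)"
  proof (rule integral_mono)
    show "integrable ?M (\<lambda>y. - c * levy_kernel (N i) \<sigma> y)"
      using integrable_levy_kernel[of \<sigma> "N i"] \<sigma> False by auto
    show "integrable ?M (\<lambda>y. frac_integrand e N i \<sigma> u p y - frac_integrand e N i \<sigma> u q y)"
      using int by auto
    fix y
    have "- c * levy_kernel (N i) \<sigma> y = (- c * min ((norm (embed e N i y))\<^sup>2) 1)
        / norm (embed e N i y) powr (real (N i) + 2 * \<sigma>)"
      by (simp only: levy_kernel_def norm_embed[OF orth] times_divide_eq_right)
    also have "\<dots> \<le> (second_diff u p (embed e N i y) - second_diff u q (embed e N i y))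
        / norm (embed e N i y) powr (real (N i) + 2 * \<sigma>)"
      by (intro divide_right_mono ge) auto
    also have "\<dots> = frac_integrand e N i \<sigma> u p y - frac_integrand e N i \<sigma> u q y"
      by (simp add: frac_integrand_def second_diff_def diff_divide_distrib)
    finally show "- c * levy_kernel (N i) \<sigma> y \<le> frac_integrand e N i \<sigma> u p y - frac_integrand e N i \<sigma> u q y" .
  qed
  also have "\<dots> = integral\<^sup>L ?M (frac_integrand e N i \<sigma> u p) - integral\<^sup>L ?M (frac_integrand e N i \<sigma> u q)"
    by (rule Bochner_Integration.integral_diff[OF int])
  finally have "frac_const (N i) \<sigma> * (- c * integral\<^sup>L ?M (levy_kernel (N i) \<sigma>)) \<le> frac_const (N i) \<sigma> *
      (integral\<^sup>L ?M (frac_integrand e N i \<sigma> u p) - integral\<^sup>L ?M (frac_integrand e N i \<sigma> u q))"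
    by (intro mult_left_mono frac_const_nonneg \<sigma>(1))
  then show ?thesis
    using False by (simp add: frac_lap_def lap_bound_def algebra_simps)
qed

section \<open>The barrier and the point of contact\<close>

text \<open>The constants make it equal to \<open>2\<close> from $|z| = 1/4$ on.\<close>

definition cutoff :: "'a::real_inner \<Rightarrow> real" where
  "cutoff z = min (32 * (norm z)\<^sup>2) 2"

text \<open>
  The quadratic \<open>32 |z|^2\<close> and the constant \<open>2\<close> both satisfy this bound, by the
  parallelogram law, and such a bound from below passes to a minimum, because the minimum equals
  one of the two at \<open>z\<close> and is at most that one elsewhere. For large \<open>y\<close>, boundedness is enough.
\<close>

lemma cutoff_semiconcave: "- 64 * min ((norm y)\<^sup>2) 1 \<le> second_diff cutoff z y"
proof -
  have par: "(norm (z + y))\<^sup>2 + (norm (z - y))\<^sup>2 = 2 * (norm z)\<^sup>2 + 2 * (norm y)\<^sup>2"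
    by (simp add: power2_norm_eq_inner algebra_simps)
  have "- 64 * min Y 1 \<le> 2 * min (32 * Z) 2 - min (32 * P) 2 - min (32 * Q) 2"
    if "P + Q = 2 * Z + 2 * Y" "0 \<le> Y" "0 \<le> Z" for P Q Y Z :: real
    using that by linarith
  then show ?thesis unfolding second_diff_def cutoff_def using par by simp
qed

text \<open>
  The points are $x_0 + z \pm s w$, where $(z,s)$ maximises the excess of the symmetric
  difference of \<open>u\<close> over the barrier. The excess is not positive for $|z| \ge 1/4$, hence the
  first inequality holds for every \<open>y\<close> in the hyperplane, as is needed for nonlocal
  operators; the second one holds only as long as $s \pm h$ stays in \<open>{0..1/4}\<close>.
\<close>

lemma touching_points:
  fixes u :: "'a::euclidean_space \<Rightarrow> real"
  assumes cont: "continuous_on UNIV u" and bound: "\<And>x. \<bar>u x\<bar> \<le> W"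
    and "norm w = 1" "0 \<le> W" "0 \<le> B" "0 \<le> t" "t \<le> 1/4"
    and large: "W * (8 + B / 4) * t < u (x0 + t *\<^sub>R w) - u (x0 - t *\<^sub>R w)"
  obtains p q where "p \<in> cball x0 (1/2)" "q \<in> cball x0 (1/2)"
    and "\<forall>y. y \<bullet> w = 0 \<longrightarrow> - (64 * W) * min ((norm y)\<^sup>2) 1 \<le> second_diff u p y - second_diff u q y"
    and "\<forall>\<^sub>F h in at_right 0. 2 * W * B * h\<^sup>2 \<le> second_diff u p (h *\<^sub>R w) - second_diff u q (h *\<^sub>R w)"
proof -
  \<comment> \<open>the excess over the barrier, with the centre moved to the origin\<close>
  define G where "G z t = u (x0 + z + t *\<^sub>R w) - u (x0 + z - t *\<^sub>R w)
      - W * (cutoff z + (8 + B / 4) * t - B * t\<^sup>2)" for z t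
  let ?S = "({z. w \<bullet> z = 0} \<inter> cball 0 (1/4)) \<times> {0..1/4::real}"
  have "compact ?S"
    by (intro compact_Times closed_Int_compact closed_hyperplane) auto
  moreover have "(0, t) \<in> ?S" using assms by auto
  moreover have "continuous_on ?S (\<lambda>(z, t). G z t)"
    unfolding G_def cutoff_def case_prod_unfold
    by (intro continuous_intros continuous_on_compose2[OF cont]) auto
  ultimately obtain x where x: "x \<in> ?S" "\<And>x'. x' \<in> ?S \<Longrightarrow> (\<lambda>(z, t). G z t) x' \<le> (\<lambda>(z, t). G z t) x"
    using continuous_attains_sup[of ?S "\<lambda>(z, t). G z t"] by blast
  obtain z s where zs: "x = (z, s)" by (cases x)
  have z: "w \<bullet> z = 0" "norm z \<le> 1/4" and s: "0 \<le> s" "s \<le> 1/4" using x(1) zs by auto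
  have max: "G z' s' \<le> G z s" if "w \<bullet> z' = 0" "norm z' \<le> 1/4" "0 \<le> s'" "s' \<le> 1/4" for z' s'
    using x(2)[of "(z', s')"] that zs by auto
  have osc: "u x - u y \<le> W * 2" for x y using bound[of x] bound[of y] by linarith
  have cut0: "0 \<le> cutoff z'" for z' :: 'a by (auto simp: cutoff_def)
  have prof: "0 \<le> (8 + B / 4) * s' - B * s'\<^sup>2" if "0 \<le> s'" "s' \<le> 1/4" for s'
  proof -
    have "B * s' * s' \<le> B * s' * (1/4)" using that assms by (intro mult_left_mono) auto
    then show ?thesis using that by (simp add: power2_eq_square algebra_simps)
  qed
  have out: "G z' s' \<le> 0"
    if "2 \<le> cutoff z' + ((8 + B / 4) * s' - B * s'\<^sup>2)" for z' s'
  proof -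
    have "W * 2 \<le> W * (cutoff z' + ((8 + B / 4) * s' - B * s'\<^sup>2))"
      using that assms by (intro mult_left_mono) auto
    then show ?thesis using osc[of "x0 + z' + s' *\<^sub>R w" "x0 + z' - s' *\<^sub>R w"]
      unfolding G_def by (simp add: algebra_simps)
  qed
  have "0 < G 0 t"
  proof -
    have "0 \<le> W * (B * t\<^sup>2)" using assms by auto
    then show ?thesis using large by (simp add: G_def cutoff_def algebra_simps)
  qed
  with max[of 0 t] assms have pos: "0 < G z s" by auto
  have "G z 0 \<le> 0" using cut0[of z] \<open>0 \<le> W\<close> by (simp add: G_def)
  with pos have "s \<noteq> 0" by auto
  have "G z (1/4) \<le> 0"
  proof (rule out)
    have "(8 + B / 4) * (1/4) - B * (1/4)\<^sup>2 = 2" by (simp add: power2_eq_square field_simps)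
    with cut0[of z] show "2 \<le> cutoff z + ((8 + B / 4) * (1/4) - B * (1/4)\<^sup>2)" by simp
  qed
  with pos have "s \<noteq> 1/4" by (metis not_less)
  with \<open>s \<noteq> 0\<close> have s': "0 < s" "s < 1/4" using s by auto
  have max_hyper: "G (z + y) s \<le> G z s" if "w \<bullet> y = 0" for y
  proof (cases "norm (z + y) \<le> 1/4")
    case True
    then show ?thesis using max z s that by (auto simp: inner_add_right)
  next
    case False
    then have "(1/4)\<^sup>2 \<le> (norm (z + y))\<^sup>2" by (intro power_mono) auto
    then have "2 \<le> cutoff (z + y)" by (auto simp: cutoff_def power2_eq_square)
    then show ?thesis using out[where z' = "z + y" and s' = s] prof[OF s] pos by auto
  qed
  define p where "p = x0 + z + s *\<^sub>R w"
  define q where "q = x0 + z - s *\<^sub>R w"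
  show thesis
  proof
    have "norm (z + s *\<^sub>R w) \<le> 1/2" "norm (z - s *\<^sub>R w) \<le> 1/2"
      using norm_triangle_ineq[of z "s *\<^sub>R w"] norm_triangle_ineq4[of z "s *\<^sub>R w"] z s assms by auto
    moreover have "dist x0 p = norm (z + s *\<^sub>R w)" "dist x0 q = norm (z - s *\<^sub>R w)"
      by (subst dist_commute, simp add: p_def q_def dist_norm)+
    ultimately show "p \<in> cball x0 (1/2)" "q \<in> cball x0 (1/2)" by simp_all
  next
    show "\<forall>y. y \<bullet> w = 0 \<longrightarrow> - (64 * W) * min ((norm y)\<^sup>2) 1 \<le> second_diff u p y - second_diff u q y"
    proof (intro allI impI)
      fix y assume y: "y \<bullet> w = 0"
      have "G (z + y) s + G (z + - y) s \<le> 2 * G z s"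
        using max_hyper[of y] max_hyper[of "- y"] y by (simp add: inner_commute)
      then have "W * second_diff cutoff z y \<le> second_diff u p y - second_diff u q y"
        by (simp add: G_def p_def q_def second_diff_def algebra_simps)
      moreover have "W * (- 64 * min ((norm y)\<^sup>2) 1) \<le> W * second_diff cutoff z y"
        using assms by (intro mult_left_mono cutoff_semiconcave) auto
      ultimately show "- (64 * W) * min ((norm y)\<^sup>2) 1 \<le> second_diff u p y - second_diff u q y"
        by (simp add: mult_ac)
    qed
  next
    have "2 * W * B * h\<^sup>2 \<le> second_diff u p (h *\<^sub>R w) - second_diff u q (h *\<^sub>R w)"
      if "0 < h" "h < min s (1/4 - s)" for h
    proof -
      have "G z (s + h) + G z (s - h) \<le> 2 * G z s"
        using max[of z "s + h"] max[of z "s - h"] z that s' by auto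
      moreover have "G z s = u p - u q - W * (cutoff z + (8 + B / 4) * s - B * s\<^sup>2)"
        by (simp add: G_def p_def q_def)
      moreover have "G z (s + h) = u (p + h *\<^sub>R w) - u (q - h *\<^sub>R w)
          - W * (cutoff z + (8 + B / 4) * (s + h) - B * (s + h)\<^sup>2)"
        by (simp add: G_def p_def q_def scaleR_add_left add.assoc diff_diff_eq)
      moreover have "G z (s - h) = u (p - h *\<^sub>R w) - u (q + h *\<^sub>R w)
          - W * (cutoff z + (8 + B / 4) * (s - h) - B * (s - h)\<^sup>2)"
        by (simp add: G_def p_def q_def scaleR_diff_left add_diff_eq diff_diff_eq2 diff_add_eq)
      ultimately show ?thesis
        by (simp add: second_diff_def field_simps power2_eq_square)
    qed
    moreover have "0 < min s (1/4 - s)" using s' by auto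
    ultimately show "\<forall>\<^sub>F h in at_right 0. 2 * W * B * h\<^sup>2 \<le> second_diff u p (h *\<^sub>R w) - second_diff u q (h *\<^sub>R w)"
      unfolding eventually_at_right_field by blast
  qed
qed

section \<open>The coordinate groups\<close>

lemma offset_pred: "1 \<le> i \<Longrightarrow> offset N i = offset N (i - 1) + N i"
  by (cases i) (auto simp: offset_def)

lemma offset_mono: "i \<le> j \<Longrightarrow> offset N i \<le> offset N j"
  unfolding offset_def by (rule sum_mono2) auto

lemma basis_enumeration_inner:
  fixes e :: "nat \<Rightarrow> real ^ 'n"
  assumes "bij_betw e {1..CARD('n)} Basis" "j \<in> {1..CARD('n)}" "k \<in> {1..CARD('n)}"
  shows "e j \<bullet> e k = (if j = k then 1 else 0)"
proof -
  have "e j \<in> Basis" "e k \<in> Basis" using assms by (auto simp: bij_betw_def)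
  moreover have "e j = e k \<longleftrightarrow> j = k" using assms by (auto simp: bij_betw_def inj_on_eq_iff)
  ultimately show ?thesis by (auto simp: inner_Basis)
qed

lemma group_vec_last:
  fixes e :: "nat \<Rightarrow> real ^ 'n"
  assumes "m \<ge> 1" "(\<Sum>i=1..<m. N i) + 1 = CARD('n)"
  shows "offset N (m - 1) + 1 = CARD('n)" "group_vec e N m 1 = e CARD('n)"
proof -
  show last: "offset N (m - 1) + 1 = CARD('n)"
    using assms unfolding offset_def by (cases m) (auto simp: atLeastLessThanSuc_atLeastAtMost)
  show "group_vec e N m 1 = e CARD('n)" unfolding group_vec_def last ..
qed

section \<open>The maximum principle argument\<close>

text \<open>
  \<open>B\<close> is chosen so that at the two points of contact the equation gives
  $f(p) - f(q) \ge 2 a B W - 64 \Lambda W = 3 W$, more than the $2W$ that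
  the bound on \<open>f\<close> allows; $\Lambda$ stands for the sum in \<open>B\<close>. Both signs of
  \<open>w\<close> are admitted to bound the derivative from both sides.
\<close>

lemma solution_symmetric_difference_le:
  fixes m :: nat and N :: "nat \<Rightarrow> nat" and a s :: "nat \<Rightarrow> real" and e :: "nat \<Rightarrow> real ^ 'n"
  assumes m: "m \<ge> 1" and Nm: "N m = 1" and card: "(\<Sum>i=1..<m. N i) + 1 = CARD('n)"
    and a: "\<And>i. i \<in> {1..<m} \<Longrightarrow> a i \<ge> 0" "a m > 0"
    and s: "\<And>i. i \<in> {1..<m} \<Longrightarrow> 0 < s i \<and> s i \<le> 1" "s m = 1"
    and e: "bij_betw e {1..CARD('n)} Basis"
    and sol: "classical_solution e m N a s (ball 0 1) f u"
    and W: "0 < W" "\<And>x. x \<in> ball 0 1 \<Longrightarrow> \<bar>f x\<bar> \<le> W" "\<And>x. \<bar>u x\<bar> \<le> W"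
    and B: "B = (64 * (\<Sum>i=1..<m. a i * lap_bound (N i) (s i)) + 3) / (2 * a m)"
    and w: "w = e CARD('n) \<or> w = - e CARD('n)"
    and x0: "x0 \<in> ball 0 (1/2)" and t: "0 \<le> t" "t \<le> 1/4"
  shows "u (x0 + t *\<^sub>R w) - u (x0 - t *\<^sub>R w) \<le> W * (8 + B / 4) * t"
proof (rule ccontr)
  define \<Lambda> where "\<Lambda> = (\<Sum>i=1..<m. a i * lap_bound (N i) (s i))"
  let ?v = "e CARD('n)"
  have "0 \<le> \<Lambda>" unfolding \<Lambda>_def using a s by (intro sum_nonneg mult_nonneg_nonneg lap_bound_nonneg) auto
  then have "0 \<le> B" using a B by (simp add: \<Lambda>_def)
  note last = group_vec_last[OF m card]
  have index: "offset N (i - 1) + k \<in> {1..CARD('n)} \<and> offset N (i - 1) + k \<noteq> CARD('n)"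
    if "i \<in> {1..<m}" "k \<in> {1..N i}" for i k
  proof -
    have "i \<le> m - 1" "1 \<le> i" using that by auto
    then show ?thesis
      using offset_pred[of i N] offset_mono[of i "m - 1" N] last(1) that(2)
      by (auto simp del: One_nat_def)
  qed
  have orth: "group_vec e N i j \<bullet> group_vec e N i k = (if j = k then 1 else 0)"
    if "i \<in> {1..<m}" "j \<in> {1..N i}" "k \<in> {1..N i}" for i j k
    unfolding group_vec_def
    using index[OF that(1,2)] index[OF that(1,3)] by (subst basis_enumeration_inner[OF e]) auto
  have "norm ?v = 1" using basis_enumeration_inner[OF e, of "CARD('n)" "CARD('n)"]
    by (simp add: norm_eq_sqrt_inner)
  have perp: "embed e N i z \<bullet> w = 0" if "i \<in> {1..<m}" for i z
  proof -
    have "group_vec e N i k \<bullet> ?v = 0" if "k \<in> {1..N i}" for k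
      unfolding group_vec_def using index[OF \<open>i \<in> {1..<m}\<close> that]
      by (subst basis_enumeration_inner[OF e]) auto
    then have "embed e N i z \<bullet> ?v = 0"
      unfolding embed_def inner_sum_left by (intro sum.neutral) auto
    then show ?thesis using w by auto
  qed
  assume "\<not> ?thesis"
  then have large: "W * (8 + B / 4) * t < u (x0 + t *\<^sub>R w) - u (x0 - t *\<^sub>R w)" by simp
  have cont: "continuous_on UNIV u" using sol by (simp add: classical_solution_def)
  have "norm w = 1" using w \<open>norm ?v = 1\<close> by auto
  obtain p q where pq: "p \<in> cball x0 (1/2)" "q \<in> cball x0 (1/2)"
    and hyper: "\<forall>y. y \<bullet> w = 0 \<longrightarrow> - (64 * W) * min ((norm y)\<^sup>2) 1 \<le> second_diff u p y - second_diff u q y"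
    and normal: "\<forall>\<^sub>F h in at_right 0. 2 * W * B * h\<^sup>2 \<le> second_diff u p (h *\<^sub>R w) - second_diff u q (h *\<^sub>R w)"
    by (rule touching_points[OF cont W(3) \<open>norm w = 1\<close> less_imp_le[OF W(1)] \<open>0 \<le> B\<close> t large])
  have in_ball: "p \<in> ball 0 1" "q \<in> ball 0 1"
  proof -
    have "norm x0 < 1/2" using x0 by simp
    then show "p \<in> ball 0 1" "q \<in> ball 0 1"
      using pq norm_triangle_ineq2[of p x0] norm_triangle_ineq2[of q x0]
      by (auto simp: dist_norm norm_minus_commute)
  qed
  have comp: "frac_lap_computable e N i (s i) u x" if "i \<in> {1..m}" "a i \<noteq> 0" "x \<in> ball 0 1" for i x
    using sol that by (auto simp: classical_solution_def)
  have group: "a i * (- (64 * W) * lap_bound (N i) (s i))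
      \<le> a i * (frac_lap e N i (s i) u p - frac_lap e N i (s i) u q)" if i: "i \<in> {1..<m}" for i
  proof (cases "a i = 0")
    case False
    have "- (64 * W) * lap_bound (N i) (s i) \<le> frac_lap e N i (s i) u p - frac_lap e N i (s i) u q"
      using i False s(1)[OF i] W in_ball
      by (intro frac_lap_diff_ge orth[OF i] comp hyper[rule_format] perp[OF i]) auto
    then show ?thesis using a(1)[OF i] by (rule mult_left_mono)
  qed simp
  have sec: "has_second_partial ?v u p" "has_second_partial ?v u q"
    using comp[of m p] comp[of m q] in_ball a(2) m s(2) Nm last(2)
    by (auto simp: frac_lap_computable_def)
  \<comment> \<open>the sign of \<open>w\<close> does not matter here, since second differences are even in \<open>h\<close>\<close>
  have "\<forall>\<^sub>F h in at_right 0. 2 * W * B * h\<^sup>2 \<le> second_diff u p (h *\<^sub>R ?v) - second_diff u q (h *\<^sub>R ?v)"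
    using normal w by (auto simp: second_diff_def algebra_simps)
  from second_partial_le_of_second_diff[OF sec this]
  have "2 * W * B \<le> frac_lap e N m (s m) u p - frac_lap e N m (s m) u q"
    using s(2) Nm last(2) by (simp add: frac_lap_def)
  then have top: "a m * (2 * W * B) \<le> a m * (frac_lap e N m (s m) u p - frac_lap e N m (s m) u q)"
    using a(2) by (intro mult_left_mono) auto
  have split: "{1..m} = insert m {1..<m}" using m by auto
  have "f p - f q = L_op e m N a s u p - L_op e m N a s u q"
    using sol in_ball by (simp add: classical_solution_def)
  also have "\<dots> = (\<Sum>i=1..m. a i * (frac_lap e N i (s i) u p - frac_lap e N i (s i) u q))"
    by (simp add: L_op_def sum_subtractf algebra_simps)
  also have "\<dots> = a m * (frac_lap e N m (s m) u p - frac_lap e N m (s m) u q)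
      + (\<Sum>i=1..<m. a i * (frac_lap e N i (s i) u p - frac_lap e N i (s i) u q))"
    unfolding split by (subst sum.insert) auto
  also have "\<dots> \<ge> a m * (2 * W * B) + (\<Sum>i=1..<m. a i * (- (64 * W) * lap_bound (N i) (s i)))"
    by (intro add_mono top sum_mono group)
  also have "(\<Sum>i=1..<m. a i * (- (64 * W) * lap_bound (N i) (s i))) = - (64 * W) * \<Lambda>"
    by (simp add: \<Lambda>_def sum_distrib_left mult_ac)
  also have "a m * (2 * W * B) + - (64 * W) * \<Lambda> = 3 * W"
  proof -
    have "2 * a m * B = 64 * \<Lambda> + 3" using a(2) unfolding B \<Lambda>_def by simp
    moreover have "a m * (2 * W * B) = W * (2 * a m * B)" by simp
    ultimately show ?thesis by (simp add: algebra_simps)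
  qed
  finally have "3 * W \<le> f p - f q" .
  moreover have "f p - f q \<le> 2 * W"
    using W(2)[OF in_ball(1)] W(2)[OF in_ball(2)] by linarith
  ultimately show False using W(1) by simp
qed

section \<open>The derivative bound\<close>

lemma deriv_le_of_symmetric_difference:
  fixes g :: "real \<Rightarrow> real"
  assumes "g differentiable (at 0)" "0 < \<delta>"
    and "\<And>t. 0 < t \<Longrightarrow> t \<le> \<delta> \<Longrightarrow> \<bar>g t - g (- t)\<bar> \<le> c * t"
  shows "2 * \<bar>deriv g 0\<bar> \<le> c"
proof -
  have D: "(g has_real_derivative deriv g 0) (at 0)"
    using assms(1) by (simp add: DERIV_deriv_iff_real_differentiable)
  then have "((\<lambda>t. g (- t)) has_real_derivative - deriv g 0) (at 0)"
    by (simp flip: DERIV_mirror)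
  with D have "((\<lambda>t. g t - g (- t)) has_real_derivative 2 * deriv g 0) (at 0)"
    by (auto intro!: derivative_eq_intros)
  then have "((\<lambda>t. (g t - g (- t)) / t) \<longlongrightarrow> 2 * deriv g 0) (at 0)"
    by (simp add: DERIV_def)
  then have "((\<lambda>t. \<bar>(g t - g (- t)) / t\<bar>) \<longlongrightarrow> \<bar>2 * deriv g 0\<bar>) (at_right 0)"
    by (intro tendsto_rabs) (rule filterlim_mono[OF _ order_refl], auto simp: at_le)
  moreover have "\<forall>\<^sub>F t in at_right 0. \<bar>(g t - g (- t)) / t\<bar> \<le> c"
    unfolding eventually_at_right_field
    using assms by (intro exI[of _ \<delta>]) (auto simp: abs_divide field_simps)
  ultimately have "\<bar>2 * deriv g 0\<bar> \<le> c"
    by (intro tendsto_upperbound) auto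
  then show ?thesis by (simp add: abs_mult)
qed

lemma Linf_norm_finite_bound:
  assumes "Linf_norm S g < \<infinity>" "x \<in> S"
  shows "\<bar>g x\<bar> \<le> enn2real (Linf_norm S g)"
proof -
  have "ennreal \<bar>g x\<bar> \<le> Linf_norm S g"
    unfolding Linf_norm_def using assms(2) by (rule SUP_upper)
  also have "\<dots> = ennreal (enn2real (Linf_norm S g))" using assms(1) by simp
  finally show ?thesis by simp
qed

theorem corollary1p2:
  fixes m :: nat and N :: "nat \<Rightarrow> nat" and a s :: "nat \<Rightarrow> real"
  assumes "m \<ge> 1"
    and "\<And>i. i \<in> {1..<m} \<Longrightarrow> N i \<ge> 1" and "N m = 1"
    and "(\<Sum>i=1..<m. N i) + 1 = CARD('n::finite)"
    and "\<And>i. i \<in> {1..<m} \<Longrightarrow> a i \<ge> 0" and "a m > 0"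
    and "\<And>i. i \<in> {1..<m} \<Longrightarrow> 0 < s i \<and> s i \<le> 1" and "s m = 1"
  shows "\<exists>C::real. C > 0 \<and>
    (\<forall>(e :: nat \<Rightarrow> real ^ 'n) (f :: real ^ 'n \<Rightarrow> real) (u :: real ^ 'n \<Rightarrow> real).
       bij_betw e {1..CARD('n)} Basis \<longrightarrow>
       classical_solution e m N a s (ball 0 1) f u \<longrightarrow>
       Linf_norm (ball 0 (1/2)) (partial_deriv (e CARD('n)) u)
         \<le> ennreal C * (Linf_norm (ball 0 1) f + Linf_norm UNIV u))"
proof -
  define B where "B = (64 * (\<Sum>i=1..<m. a i * lap_bound (N i) (s i)) + 3) / (2 * a m)"
  define C where "C = 8 + B / 4"
  have "0 \<le> (\<Sum>i=1..<m. a i * lap_bound (N i) (s i))"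
    using assms by (intro sum_nonneg mult_nonneg_nonneg lap_bound_nonneg) auto
  then have "0 \<le> B" using assms by (simp add: B_def)
  then have C: "0 < C" by (simp add: C_def)
  show ?thesis
  proof (intro exI[of _ C] conjI allI impI C)
    fix e :: "nat \<Rightarrow> real ^ 'n" and f u :: "real ^ 'n \<Rightarrow> real"
    assume e: "bij_betw e {1..CARD('n)} Basis"
      and sol: "classical_solution e m N a s (ball 0 1) f u"
    let ?v = "e CARD('n)"
    let ?F = "Linf_norm (ball 0 1) f" and ?U = "Linf_norm UNIV u"
    show "Linf_norm (ball 0 (1/2)) (partial_deriv ?v u) \<le> ennreal C * (?F + ?U)"
    proof (cases "?F + ?U < \<infinity>")
      case False
      then have "?F + ?U = top" by (simp only: infinity_ennreal_def less_top[symmetric] not_not)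
      moreover have "ennreal C * top = top" using C by (simp add: ennreal_mult_top)
      ultimately show ?thesis by (simp only: top_greatest)
    next
      case True
      then have fin: "?F < \<infinity>" "?U < \<infinity>" by (auto simp: less_top[symmetric])
      define R where "R = enn2real ?F + enn2real ?U"
      have "\<bar>partial_deriv ?v u x0\<bar> \<le> C * R" if x0: "x0 \<in> ball 0 (1/2)" for x0
      proof (rule field_le_epsilon)
        \<comment> \<open>the margin makes \<open>W\<close> positive even if \<open>u\<close> and \<open>f\<close> vanish\<close>
        fix \<epsilon> :: real assume "0 < \<epsilon>"
        define W where "W = R + \<epsilon> / C"
        have W: "0 < W" "enn2real ?F \<le> W" "enn2real ?U \<le> W"
          using \<open>0 < \<epsilon>\<close> C by (auto simp: W_def R_def add_nonneg_pos add_increasing2)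
        have fW: "\<bar>f x\<bar> \<le> W" if "x \<in> ball 0 1" for x
          using Linf_norm_finite_bound[OF fin(1) that] W by linarith
        have uW: "\<bar>u x\<bar> \<le> W" for x
          using Linf_norm_finite_bound[OF fin(2), of x] W by simp
        have diff: "u (x0 + t *\<^sub>R w) - u (x0 - t *\<^sub>R w) \<le> W * C * t"
          if "w = ?v \<or> w = - ?v" "0 \<le> t" "t \<le> 1/4" for w t
          unfolding C_def
          by (rule solution_symmetric_difference_le[OF assms(1,3-8) e sol W(1) fW uW B_def that(1) x0 that(2,3)])
        have "x0 \<in> ball 0 1" using x0 by auto
        with sol assms(1,6) have "frac_lap_computable e N m (s m) u x0"
          by (auto simp: classical_solution_def)
        then have "has_second_partial ?v u x0"
          using assms(3,8) group_vec_last(2)[OF assms(1,4), of e] by (auto simp: frac_lap_computable_def)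
        then have "(\<lambda>r. u (x0 + r *\<^sub>R ?v)) differentiable (at 0)"
          unfolding has_second_partial_def by (blast dest: eventually_nhds_x_imp_x)
        moreover have "\<bar>u (x0 + t *\<^sub>R ?v) - u (x0 + (- t) *\<^sub>R ?v)\<bar> \<le> W * C * t"
          if "0 < t" "t \<le> 1/4" for t
          using diff[of ?v t] diff[of "- ?v" t] that by (simp add: abs_le_iff)
        ultimately have "2 * \<bar>partial_deriv ?v u x0\<bar> \<le> W * C"
          unfolding partial_deriv_def by (intro deriv_le_of_symmetric_difference[where \<delta> = "1/4"]) auto
        moreover have "W * C = C * R + \<epsilon>" using C by (simp add: W_def field_simps)
        ultimately show "\<bar>partial_deriv ?v u x0\<bar> \<le> C * R + \<epsilon>" by linarith
      qed
      then have "Linf_norm (ball 0 (1/2)) (partial_deriv ?v u) \<le> ennreal (C * R)"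
        unfolding Linf_norm_def by (intro SUP_least ennreal_leI) auto
      also have "\<dots> = ennreal C * (?F + ?U)"
        using C fin by (simp add: R_def ennreal_mult' ennreal_plus)
      finally show ?thesis .
    qed
  qed
qed

end
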